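(* Let $r$, $m$ and $t$ be positive integers satisfying $m=\binom{t}{r}-3$. Let $C_{r,m}$ be the $r$-graph whose edge set consists of the first $m$ sets in the colex ordering of $\mathbb{N}^{(r)}$. Then $C_{r,m}$ has the largest Lagrangian among all $r$-graphs with $m$ edges and $t$ vertices, i.e. $\lambda(C_{r,m})\ge \lambda(G)$ for every $r$-graph $G$ on $t$ vertices with exactly $m$ edges.
   Context: An $r$-graph (r-uniform graph) $G$ consists of a vertex set $V(G)$ and an edge set $E(G)\subseteq V(G)^{(r)}$, where $V^{(r)}$ denotes the family of all $r$-element subsets of $V$. For an $r$-graph $G$ on vertex set $[n]=\{1,\dots,n\}$ and $\vec x=(x_1,\dots,x_n)\in\mathbb{R}^n$, set $\lambda(G,\vec x)=\sum_{i_1\cdots i_r\in E(G)} x_{i_1}\cdots x_{i_r}$. The Lagrangian of $G$ is $\lambda(G)=\max\{\lambda(G,\vec x): \sum_{i=1}^n x_i=1,\ x_i\ge 0\}$. Colex ordering on $\mathbb{N}^{(r)}$: for distinct $A,B\in\mathbb{N}^{(r)}$, $A<B$ iff $\max(A\triangle B)\in B$, where $A\triangle B=(A\setminus B)\cup(B\setminus A)$ (e.g. for $r=3$: $123<124<134<234<125<135<\cdots$). *)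

theory Defs
  imports "HOL-Analysis.Analysis" "HOL-Library.Ramsey"
begin

definition r_graph :: "nat \<Rightarrow> 'a set \<Rightarrow> 'a set set \<Rightarrow> bool" where
  "r_graph r V E \<longleftrightarrow> finite V \<and> E \<subseteq> [V]\<^bsup>r\<^esup>"

definition weightings :: "'a set \<Rightarrow> ('a \<Rightarrow> real) set" where
  "weightings V = {x. (\<forall>i\<in>V. 0 \<le> x i) \<and> (\<Sum>i\<in>V. x i) = 1}"

definition edge_poly :: "'a set set \<Rightarrow> ('a \<Rightarrow> real) \<Rightarrow> real" where
  "edge_poly E x = (\<Sum>e\<in>E. \<Prod>i\<in>e. x i)"

(* The supremum is a maximum whenever V is nonempty: see lagrangian_attained. *)
definition lagrangian :: "'a set \<Rightarrow> 'a set set \<Rightarrow> real" where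
  "lagrangian V E = (SUP x\<in>weightings V. edge_poly E x)"

(* Meant for finite sets only, since Max is unspecified on infinite ones. *)
definition colex_less :: "nat set \<Rightarrow> nat set \<Rightarrow> bool" where
  "colex_less A B \<longleftrightarrow> A \<noteq> B \<and> Max (sym_diff A B) \<in> B"

(* The first m sets are those with fewer than m predecessors; every r-set has only finitely
   many predecessors in colex (colex_predecessors_finite), so the use of card is meaningful. *)
definition colex_edges :: "nat \<Rightarrow> nat \<Rightarrow> nat set set" where
  "colex_edges r m =
     {A \<in> [{1..}]\<^bsup>r\<^esup>. card {B \<in> [{1..}]\<^bsup>r\<^esup>. colex_less B A} < m}"


lemma lagrangian_attained:
  assumes "r_graph r V E" "V \<noteq> {}"
  shows "\<exists>x\<in>weightings V. edge_poly E x = lagrangian V E \<and>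
           (\<forall>y\<in>weightings V. edge_poly E y \<le> lagrangian V E)"
proof -
  have V: "finite V" and E: "E \<subseteq> [V]\<^bsup>r\<^esup>" using assms by (auto simp: r_graph_def)
  define B where "B = (\<lambda>i. if i \<in> V then {0..1} else {0::real})"
  define S where "S = PiE UNIV B \<inter> {x. (\<Sum>i\<in>V. x i) = 1}"
  have "compactin (product_topology (\<lambda>_. euclidean) UNIV) (PiE UNIV B)"
    by (auto simp: compactin_PiE B_def)
  then have "compact (PiE UNIV B)"
    by (simp add: euclidean_product_topology)
  moreover have "closed {x :: 'a \<Rightarrow> real. (\<Sum>i\<in>V. x i) = 1}"
    by (intro closed_Collect_eq continuous_intros continuous_on_product_coordinates)
  ultimately have cS: "compact S" unfolding S_def by (rule compact_Int_closed)
  obtain v where v: "v \<in> V" using assms by auto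
  have "(\<lambda>i. if i = v then 1 else 0) \<in> S"
    using v V by (auto simp: S_def B_def)
  then have "S \<noteq> {}" by auto
  moreover have "continuous_on S (edge_poly E)" unfolding edge_poly_def
    by (intro continuous_intros continuous_on_subset[OF continuous_on_product_coordinates]) auto
  ultimately obtain x where x: "x \<in> S" and xmax: "\<And>y. y \<in> S \<Longrightarrow> edge_poly E y \<le> edge_poly E x"
    using continuous_attains_sup[OF cS] by blast
  have "x i \<in> B i" for i using x by (auto simp: S_def PiE_iff)
  then have "0 \<le> x i" if "i \<in> V" for i
    using that by (metis B_def atLeastAtMost_iff)
  then have xW: "x \<in> weightings V"
    using x by (auto simp: S_def weightings_def)
  have le: "edge_poly E y \<le> edge_poly E x" if y: "y \<in> weightings V" for y
  proof -
    define z where "z = (\<lambda>i. if i \<in> V then y i else 0)"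
    have "edge_poly E z = edge_poly E y" unfolding edge_poly_def
      using E by (intro sum.cong prod.cong refl) (auto simp: z_def nsets_def)
    moreover have "y i \<le> 1" if "i \<in> V" for i
      using y V that member_le_sum[of i V y] by (auto simp: weightings_def)
    then have "z \<in> S"
      using y by (auto simp: S_def B_def z_def weightings_def)
    ultimately show ?thesis using xmax by metis
  qed
  have "lagrangian V E = edge_poly E x"
    unfolding lagrangian_def using xW le by (intro cSup_eq_maximum) auto
  then show ?thesis using xW le by auto
qed


lemma colex_less_iff:
  assumes "finite A" "finite B"
  shows "colex_less A B \<longleftrightarrow> (\<exists>k. k \<in> B \<and> k \<notin> A \<and> (\<forall>j>k. j \<in> A \<longleftrightarrow> j \<in> B))"
proof
  assume *: "colex_less A B"
  then have "sym_diff A B \<noteq> {}" by (auto simp: colex_less_def)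
  then have "Max (sym_diff A B) \<in> sym_diff A B" using assms by (intro Max_in) auto
  moreover have "j \<in> A \<longleftrightarrow> j \<in> B" if "j > Max (sym_diff A B)" for j
    using that assms Max_ge[of "sym_diff A B" j] by fastforce
  ultimately show "\<exists>k. k \<in> B \<and> k \<notin> A \<and> (\<forall>j>k. j \<in> A \<longleftrightarrow> j \<in> B)"
    using * by (intro exI[of _ "Max (sym_diff A B)"]) (auto simp: colex_less_def)
next
  assume "\<exists>k. k \<in> B \<and> k \<notin> A \<and> (\<forall>j>k. j \<in> A \<longleftrightarrow> j \<in> B)"
  then obtain k where k: "k \<in> B" "k \<notin> A" "\<And>j. j > k \<Longrightarrow> j \<in> A \<longleftrightarrow> j \<in> B" by auto
  then have "Max (sym_diff A B) = k"
    using assms by (intro Max_eqI) (auto intro: leI)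
  then show "colex_less A B" using k by (auto simp: colex_less_def)
qed

lemma colex_less_irrefl: "\<not> colex_less A A"
  by (simp add: colex_less_def)

lemma colex_less_linear:
  assumes "finite A" "finite B" "A \<noteq> B"
  shows "colex_less A B \<or> colex_less B A"
proof -
  have "sym_diff A B \<noteq> {}" using assms by auto
  then have "Max (sym_diff A B) \<in> sym_diff A B" using assms by (intro Max_in) auto
  then show ?thesis using assms by (auto simp: colex_less_def Un_commute)
qed

lemma colex_less_trans:
  assumes "finite A" "finite B" "finite C" "colex_less A B" "colex_less B C"
  shows "colex_less A C"
proof -
  obtain a where a: "a \<in> B" "a \<notin> A" "\<And>j. j > a \<Longrightarrow> j \<in> A \<longleftrightarrow> j \<in> B"
    using assms by (auto simp: colex_less_iff)
  obtain c where c: "c \<in> C" "c \<notin> B" "\<And>j. j > c \<Longrightarrow> j \<in> B \<longleftrightarrow> j \<in> C"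
    using assms by (auto simp: colex_less_iff)
  have "a \<noteq> c" using a c by auto
  then have "max a c \<in> C \<and> max a c \<notin> A \<and> (\<forall>j>max a c. j \<in> A \<longleftrightarrow> j \<in> C)"
    using a c by (auto simp: max_def)
  then show ?thesis using assms colex_less_iff by blast
qed

lemma colex_less_subset:
  assumes "finite B" "colex_less B A" "A \<subseteq> {1..t}" "B \<subseteq> {1..}"
  shows "B \<subseteq> {1..t}"
proof -
  have "finite A" using assms finite_subset by blast
  then obtain k where k: "k \<in> A" "\<And>j. j > k \<Longrightarrow> j \<in> B \<longleftrightarrow> j \<in> A"
    using assms by (auto simp: colex_less_iff)
  show ?thesis
  proof
    fix j assume j: "j \<in> B"
    have "k \<le> t" using k assms by auto
    then show "j \<in> {1..t}" using j k(2)[of j] assms by (cases "j > k") auto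
  qed
qed

lemma colex_predecessors_subset:
  assumes "A \<in> [{1..t}]\<^bsup>r\<^esup>"
  shows "{B \<in> [{1..}]\<^bsup>r\<^esup>. colex_less B A} \<subseteq> [{1..t}]\<^bsup>r\<^esup>"
  using assms colex_less_subset by (fastforce simp: nsets_def)

lemma nsets_initial:
  assumes "A \<in> [{1..}]\<^bsup>r\<^esup>"
  shows "A \<in> [{1..Max (insert 0 A)}]\<^bsup>r\<^esup>"
  using assms by (auto simp: nsets_def)

lemma colex_predecessors_finite:
  assumes "A \<in> [{1..}]\<^bsup>r\<^esup>"
  shows "finite {B \<in> [{1..}]\<^bsup>r\<^esup>. colex_less B A}"
  using colex_predecessors_subset[OF nsets_initial[OF assms]]
  by (rule finite_subset) (simp add: finite_imp_finite_nsets)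

lemma colex_edges_r_graph:
  assumes "m \<le> t choose r"
  shows "r_graph r {1..t} (colex_edges r m)" and "card (colex_edges r m) = m"
proof -
  let ?S = "[{1..t}]\<^bsup>r\<^esup>"
  let ?pred = "\<lambda>A. {B \<in> [{1..}]\<^bsup>r\<^esup>. colex_less B A}"
  let ?rk = "\<lambda>A. card (?pred A)"
  have fS: "finite ?S" by (simp add: finite_imp_finite_nsets)
  have cS: "card ?S = t choose r"
  proof -
    have "?S = {B. B \<subseteq> {1..t} \<and> card B = r}"
      by (auto simp: nsets_def intro: finite_subset)
    then show ?thesis using n_subsets[of "{1..t}" r] by simp
  qed
  have SN: "?S \<subseteq> [{1..}]\<^bsup>r\<^esup>" by (rule nsets_mono) auto
  have fin: "finite A" if "A \<in> [{1..}]\<^bsup>r\<^esup>" for A :: "nat set"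
    using that by (auto simp: nsets_def)
  have mono: "?rk A < ?rk B"
    if "A \<in> [{1..}]\<^bsup>r\<^esup>" "B \<in> [{1..}]\<^bsup>r\<^esup>" "colex_less A B" for A B
  proof (rule psubset_card_mono)
    show "finite (?pred B)" by (rule colex_predecessors_finite) (rule that)
    have "?pred A \<subseteq> ?pred B" using that fin colex_less_trans[of _ A B] by blast
    moreover have "A \<in> ?pred B" "A \<notin> ?pred A" using that colex_less_irrefl by auto
    ultimately show "?pred A \<subset> ?pred B" by blast
  qed
  have inj: "inj_on ?rk ?S"
  proof (rule inj_onI, rule ccontr)
    fix A B assume AB: "A \<in> ?S" "B \<in> ?S" "?rk A = ?rk B" "A \<noteq> B"
    then have "A \<in> [{1..}]\<^bsup>r\<^esup>" "B \<in> [{1..}]\<^bsup>r\<^esup>" using SN by auto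
    with AB show False
      using mono[of A B] mono[of B A] colex_less_linear[of A B] fin by auto
  qed
  have rk_less: "?rk A < t choose r" if "A \<in> ?S" for A
  proof -
    have "?pred A \<subset> ?S" using colex_predecessors_subset[OF that] that colex_less_irrefl by blast
    then show ?thesis using psubset_card_mono[OF fS] cS by metis
  qed
  have im: "?rk ` ?S = {..<t choose r}"
  proof (rule card_subset_eq)
    show "?rk ` ?S \<subseteq> {..<t choose r}" using rk_less by auto
    show "card (?rk ` ?S) = card {..<t choose r}" using card_image[OF inj] cS by simp
  qed simp
  have out: "t choose r \<le> ?rk A" if A: "A \<in> [{1..}]\<^bsup>r\<^esup>" "A \<notin> ?S" for A
  proof -
    have "?S \<subseteq> ?pred A"
    proof
      fix B assume B: "B \<in> ?S"
      then have BN: "B \<in> [{1..}]\<^bsup>r\<^esup>" using SN by auto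
      have "\<not> colex_less A B" using colex_predecessors_subset[OF B] A by blast
      then show "B \<in> ?pred A" using colex_less_linear[of A B] A B BN fin by auto
    qed
    then show ?thesis using card_mono[OF colex_predecessors_finite[OF A(1)]] cS by metis
  qed
  have eq: "colex_edges r m = {A \<in> ?S. ?rk A < m}"
  proof -
    have "A \<in> ?S" if "A \<in> [{1..}]\<^bsup>r\<^esup>" "?rk A < m" for A
      using out[of A] that assms by linarith
    then show ?thesis unfolding colex_edges_def using SN by blast
  qed
  then show "r_graph r {1..t} (colex_edges r m)" by (auto simp: r_graph_def)
  have "?rk ` colex_edges r m = {..<m}"
  proof -
    have "?rk ` colex_edges r m = ?rk ` ?S \<inter> {..<m}" unfolding eq by auto
    then show ?thesis unfolding im using assms by auto
  qed
  moreover have "inj_on ?rk (colex_edges r m)" using inj eq by (auto intro: inj_on_subset)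
  ultimately show "card (colex_edges r m) = m" using card_image by (metis card_lessThan)
qed

end

theory Submission
  imports Defs
begin

text \<open>Relabel the vertices so that an optimal weighting of \<open>G\<close> is decreasing on \<open>{1..t}\<close>, and let
  \<open>T\<close> be the last \<open>r - 2\<close> vertices, preceded by \<open>d < c < b < a\<close> (for \<open>r \<ge> 2\<close>). Among all triples of \<open>r\<close>-sets
  one of least total weight is \<open>T\<close> joined with the edges of the star \<open>ab, ac, ad\<close> or with those of
  the triangle \<open>ab, ac, bc\<close>. Colex omits the star, except for \<open>t = r + 1\<close>, where \<open>d\<close> does not exist
  and it omits the triangle. It remains to see that omitting the star is at least as good as
  omitting the triangle: changing only the weights of \<open>a, b, c, d\<close>, one can average over \<open>a, b, c\<close>
  and then pass to weights for which the star costs as much as the triangle did, while every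
  elementary symmetric polynomial of the four weights grows.\<close>

section \<open>Elementary symmetric polynomials\<close>

lemma nsets_insert_Suc:
  assumes "finite A" "a \<notin> A"
  shows "[insert a A]\<^bsup>Suc k\<^esup> = [A]\<^bsup>Suc k\<^esup> \<union> insert a ` [A]\<^bsup>k\<^esup>"
proof (intro set_eqI iffI)
  fix S assume S: "S \<in> [insert a A]\<^bsup>Suc k\<^esup>"
  show "S \<in> [A]\<^bsup>Suc k\<^esup> \<union> insert a ` [A]\<^bsup>k\<^esup>"
  proof (cases "a \<in> S")
    case True
    then have "S = insert a (S - {a})" "S - {a} \<in> [A]\<^bsup>k\<^esup>"
      using S by (auto simp: nsets_def)
    then show ?thesis by blast
  next
    case False
    then show ?thesis using S by (auto simp: nsets_def)
  qed
next
  fix S assume "S \<in> [A]\<^bsup>Suc k\<^esup> \<union> insert a ` [A]\<^bsup>k\<^esup>"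
  then show "S \<in> [insert a A]\<^bsup>Suc k\<^esup>"
    using assms by (auto simp: nsets_def card_insert_if)
qed

text \<open>On a complete graph \<open>edge_poly\<close> is an elementary symmetric polynomial of
  the weights; splitting the sets by membership of \<open>a\<close> gives the usual
  recurrence.\<close>

lemma edge_poly_nsets_insert:
  assumes "finite A" "a \<notin> A"
  shows "edge_poly ([insert a A]\<^bsup>Suc k\<^esup>) x = edge_poly ([A]\<^bsup>Suc k\<^esup>) x + x a * edge_poly ([A]\<^bsup>k\<^esup>) x"
proof -
  have inj: "inj_on (insert a) ([A]\<^bsup>k\<^esup>)"
    using assms by (auto simp: inj_on_def nsets_def insert_ident)
  have "edge_poly ([insert a A]\<^bsup>Suc k\<^esup>) x
      = edge_poly ([A]\<^bsup>Suc k\<^esup>) x + (\<Sum>S\<in>insert a ` [A]\<^bsup>k\<^esup>. \<Prod>i\<in>S. x i)"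
    unfolding edge_poly_def nsets_insert_Suc[OF assms]
    using assms by (intro sum.union_disjoint) (auto simp: finite_imp_finite_nsets nsets_def)
  also have "(\<Sum>S\<in>insert a ` [A]\<^bsup>k\<^esup>. \<Prod>i\<in>S. x i) = (\<Sum>S\<in>[A]\<^bsup>k\<^esup>. x a * (\<Prod>i\<in>S. x i))"
    unfolding sum.reindex[OF inj] using assms
    by (intro sum.cong) (auto simp: nsets_def intro!: prod.insert)
  finally show ?thesis by (simp add: edge_poly_def sum_distrib_left)
qed

lemma edge_poly_nonneg:
  assumes "r_graph r V E" "\<And>i. i \<in> V \<Longrightarrow> 0 \<le> x i"
  shows "0 \<le> edge_poly E x"
  unfolding edge_poly_def using assms
  by (intro sum_nonneg prod_nonneg) (auto simp: r_graph_def nsets_def)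

text \<open>Counting the degree downwards from \<open>r\<close> and padding with \<open>0\<close> makes the recurrence below
  free of side conditions on \<open>j\<close>.\<close>

definition esym_below :: "nat \<Rightarrow> nat \<Rightarrow> 'a set \<Rightarrow> ('a \<Rightarrow> real) \<Rightarrow> real" where
  "esym_below r j A x = (if j \<le> r then edge_poly ([A]\<^bsup>(r - j)\<^esup>) x else 0)"

lemma esym_below_insert:
  assumes "finite A" "a \<notin> A"
  shows "esym_below r j (insert a A) x = esym_below r j A x + x a * esym_below r (Suc j) A x"
proof (cases "Suc j \<le> r")
  case True
  then have "r - j = Suc (r - Suc j)" by simp
  then show ?thesis
    using True edge_poly_nsets_insert[OF assms, of "r - Suc j" x] by (simp add: esym_below_def)
next
  case False
  \<comment> \<open>At \<open>j = r\<close> the empty set is the only summand on either side, so the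
    zero that pads \<open>Suc j\<close> is the right value; beyond \<open>r\<close> every term is
    zero.\<close>
  then show ?thesis using assms by (cases "j = r") (auto simp: esym_below_def)
qed

lemma esym_below_nonneg:
  assumes "finite A" "\<And>i. i \<in> A \<Longrightarrow> 0 \<le> x i"
  shows "0 \<le> esym_below r j A x"
  using edge_poly_nonneg[of "r - j" A] assms by (auto simp: esym_below_def r_graph_def)

text \<open>The coefficients are the elementary symmetric polynomials of the four weights, in
  degrees 0 to 4. They are grouped around \<open>x d\<close> because the averaging affects only the
  other three weights.\<close>

lemma esym_below_insert4:
  assumes "finite A" "distinct [a, b, c, d]" "set [a, b, c, d] \<inter> A = {}"
  shows "esym_below r 0 (insert a (insert b (insert c (insert d A)))) x =
    esym_below r 0 A x + (x a + x b + x c + x d) * esym_below r 1 A x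
    + (x a * x b + x a * x c + x b * x c + (x a + x b + x c) * x d) * esym_below r 2 A x
    + (x a * x b * x c + (x a * x b + x a * x c + x b * x c) * x d) * esym_below r 3 A x
    + x a * x b * x c * x d * esym_below r 4 A x"
  using assms
  by (simp add: esym_below_insert algebra_simps numeral_2_eq_2 numeral_3_eq_3 eval_nat_numeral)

section \<open>Four weights: from the triangle to the star\<close>

lemma esym3_le_mean:
  fixes a b c :: real
  assumes "0 \<le> a" "0 \<le> b" "0 \<le> c" "p = (a + b + c) / 3"
  shows "a * b + a * c + b * c \<le> 3 * p\<^sup>2" and "a * b * c \<le> p ^ 3"
proof -
  have s: "a + b + c = 3 * p" using assms by simp
  have sq: "9 * p\<^sup>2 - 3 * (a * b + a * c + b * c) = ((a - b)\<^sup>2 + (a - c)\<^sup>2 + (b - c)\<^sup>2) / 2"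
    unfolding assms(4) by (simp add: power2_eq_square field_simps)
  have "0 \<le> 9 * p\<^sup>2 - 3 * (a * b + a * c + b * c)" unfolding sq by simp
  then have "3 * (a * b + a * c + b * c) \<le> 3 * (3 * p\<^sup>2)" by simp
  then show e2: "a * b + a * c + b * c \<le> 3 * p\<^sup>2" by (rule mult_left_le_imp_le) simp
  \<comment> \<open>The square of the second elementary symmetric polynomial is at least three times
    the product of the first and the third; together with \<open>e2\<close> this bounds the
    third.\<close>
  have e3: "(a * b + a * c + b * c)\<^sup>2 - 9 * p * (a * b * c)
      = ((a * b - a * c)\<^sup>2 + (a * b - b * c)\<^sup>2 + (a * c - b * c)\<^sup>2) / 2"
    unfolding assms(4) by (simp add: power2_eq_square field_simps)
  have p: "0 \<le> p" using assms by simp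
  have "0 \<le> (a * b + a * c + b * c)\<^sup>2 - 9 * p * (a * b * c)" unfolding e3 by simp
  then have "9 * p * (a * b * c) \<le> (a * b + a * c + b * c)\<^sup>2" by simp
  also have "\<dots> \<le> (3 * p\<^sup>2)\<^sup>2" using assms e2 by (intro power_mono) auto
  also have "\<dots> = 9 * p * p ^ 3" by (simp add: power2_eq_square power3_eq_cube)
  finally have *: "9 * p * (a * b * c) \<le> 9 * p * p ^ 3" .
  show "a * b * c \<le> p ^ 3"
  proof (cases "p = 0")
    case True
    then have "a = 0" using s assms by linarith
    then show ?thesis using p by simp
  next
    case False
    then show ?thesis using * p by simp
  qed
qed

text \<open>The vertices of weights \<open>p, p, p, q\<close> carrying the triangle get the weights \<open>\<alpha>, \<alpha>, \<alpha>, \<delta>\<close>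
  for a star with center \<open>\<delta>\<close>. The missing part of the polynomial stays equal because
  \<open>3 \<alpha> \<delta> = 3 p\<^sup>2\<close>, and with \<open>\<alpha> = u\<^sup>2\<close> and \<open>\<delta> = v\<^sup>2\<close> each elementary symmetric
  polynomial grows by a nonnegative multiple of \<open>(u - v)\<^sup>3\<close>.\<close>

lemma star_weights_exist:
  fixes p q :: real
  assumes "0 \<le> p" "p \<le> q"
  obtains \<alpha> \<delta> where "0 \<le> \<alpha>" "0 \<le> \<delta>" "\<alpha> * \<delta> = p\<^sup>2" "3 * \<alpha> + \<delta> = 3 * p + q"
    "p\<^sup>2 + p * q \<le> \<alpha>\<^sup>2 + \<alpha> * \<delta>" "p ^ 3 + 3 * p\<^sup>2 * q \<le> \<alpha> ^ 3 + 3 * \<alpha>\<^sup>2 * \<delta>"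
    "p ^ 3 * q \<le> \<alpha> ^ 3 * \<delta>"
proof -
  \<comment> \<open>Eliminating \<open>\<delta>\<close> from
    \<open>\<alpha> * \<delta> = p\<^sup>2\<close> and \<open>3 * \<alpha> + \<delta> = s\<close>
    gives \<open>3 * \<alpha>\<^sup>2 - s * \<alpha> + p\<^sup>2 = 0\<close>. Its discriminant is
    \<open>w\<^sup>2\<close>, and the larger root \<open>(s + w) / 6\<close> is chosen for
    \<open>\<alpha>\<close>.\<close>
  define s w where "s = 3 * p + q" and "w = sqrt (s\<^sup>2 - 12 * p\<^sup>2)"
  have s: "4 * p \<le> s" "0 \<le> s" using assms by (auto simp: s_def)
  then have "(4 * p)\<^sup>2 \<le> s\<^sup>2" using assms by (intro power_mono) auto
  then have sp: "16 * p\<^sup>2 \<le> s\<^sup>2" by (simp add: power_mult_distrib)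
  have p2: "0 \<le> p\<^sup>2" by simp
  have "0 \<le> s\<^sup>2 - 12 * p\<^sup>2" using sp p2 by linarith
  then have w2: "w\<^sup>2 = s\<^sup>2 - 12 * p\<^sup>2" and w0: "0 \<le> w" by (auto simp: w_def)
  have "w\<^sup>2 \<le> s\<^sup>2" using w2 p2 by linarith
  then have ws: "w \<le> s" using s(2) by (rule power2_le_imp_le)
  \<comment> \<open>The aim is \<open>v \<le> u\<close>, which amounts to
    \<open>s \<le> 2 * w\<close>. By the formula for \<open>w\<close> this reduces to
    \<open>4 * p \<le> s\<close>, that is, to \<open>p \<le> q\<close>.\<close>
  have "s\<^sup>2 \<le> (2 * w)\<^sup>2" using w2 sp by (simp add: power_mult_distrib)
  then have sw: "s \<le> 2 * w" by (rule power2_le_imp_le) (use w0 in simp)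
  define u v where "u = sqrt ((s + w) / 6)" and "v = sqrt ((s - w) / 2)"
  have u2: "u\<^sup>2 = (s + w) / 6" and v2: "v\<^sup>2 = (s - w) / 2"
    using s w0 ws by (auto simp: u_def v_def)
  have v: "0 \<le> v" using ws by (simp add: v_def)
  have uv: "v \<le> u" unfolding u_def v_def using sw by (intro real_sqrt_le_mono) (simp add: field_simps)
  have u: "0 \<le> u" using uv v by linarith
  have "(u * v)\<^sup>2 = (s\<^sup>2 - w\<^sup>2) / 12"
    unfolding power_mult_distrib u2 v2 by (simp add: power2_eq_square field_simps)
  also have "\<dots> = p\<^sup>2" using w2 by simp
  finally have p: "p = u * v" using assms u v by (simp add: power2_eq_iff_nonneg)
  have q: "q = 3 * u\<^sup>2 + v\<^sup>2 - 3 * (u * v)"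
    using u2 v2 p by (simp add: s_def)
  have d: "0 \<le> (u - v) ^ 3" using uv by simp
  show ?thesis
  proof
    show "0 \<le> u\<^sup>2" "0 \<le> v\<^sup>2" by auto
    show "u\<^sup>2 * v\<^sup>2 = p\<^sup>2" by (simp add: p power_mult_distrib)
    show "3 * u\<^sup>2 + v\<^sup>2 = 3 * p + q" by (simp add: p q)
    have "(u\<^sup>2)\<^sup>2 + u\<^sup>2 * v\<^sup>2 - (p\<^sup>2 + p * q) = u * (u - v) ^ 3"
      unfolding p q by algebra
    then show "p\<^sup>2 + p * q \<le> (u\<^sup>2)\<^sup>2 + u\<^sup>2 * v\<^sup>2"
      using mult_nonneg_nonneg[OF u d] by linarith
    have "(u\<^sup>2) ^ 3 + 3 * (u\<^sup>2)\<^sup>2 * v\<^sup>2 - (p ^ 3 + 3 * p\<^sup>2 * q) = u\<^sup>2 * (u + 3 * v) * (u - v) ^ 3"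
      unfolding p q by algebra
    moreover have "0 \<le> u\<^sup>2 * (u + 3 * v) * (u - v) ^ 3" using u v d by simp
    ultimately show "p ^ 3 + 3 * p\<^sup>2 * q \<le> (u\<^sup>2) ^ 3 + 3 * (u\<^sup>2)\<^sup>2 * v\<^sup>2" by linarith
    have "(u\<^sup>2) ^ 3 * v\<^sup>2 - p ^ 3 * q = u ^ 3 * v\<^sup>2 * (u - v) ^ 3"
      unfolding p q by algebra
    moreover have "0 \<le> u ^ 3 * v\<^sup>2 * (u - v) ^ 3" using u v d by simp
    ultimately show "p ^ 3 * q \<le> (u\<^sup>2) ^ 3 * v\<^sup>2" by linarith
  qed
qed

text \<open>Averaging \<open>x a\<close>, \<open>x b\<close>, \<open>x c\<close> may also increase
  the weight of the missing triangle. Nothing is lost, because the same terms occur in the complete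
  polynomial: in degree two the triangle keeps the nonnegative coefficient \<open>E 2 - Q\<close>.
  The star weights then raise the complete polynomial without changing the missing part.\<close>

lemma triangle_le_star:
  fixes x :: "'a \<Rightarrow> real"
  assumes W: "finite W" and dist: "distinct [a, b, c, d]" and disj: "set [a, b, c, d] \<inter> W = {}"
    and V: "V = insert a (insert b (insert c (insert d W)))"
    and T: "T \<subseteq> W" "card T = r - 2" "2 \<le> r"
    and nonneg: "\<And>i. i \<in> V \<Longrightarrow> 0 \<le> x i"
    and le: "x a \<le> x d" "x b \<le> x d" "x c \<le> x d"
  obtains z where "\<And>i. i \<in> V \<Longrightarrow> 0 \<le> z i" "sum z V = sum x V"
    "edge_poly ([V]\<^bsup>r\<^esup>) x - (x a * x b + x a * x c + x b * x c) * prod x T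
      \<le> edge_poly ([V]\<^bsup>r\<^esup>) z - z a * (z b + z c + z d) * prod z T"
proof -
  define p q where "p = (x a + x b + x c) / 3" and "q = x d"
  have ab: "0 \<le> x a" "0 \<le> x b" "0 \<le> x c" "0 \<le> x d" using nonneg V by auto
  have mean: "x a * x b + x a * x c + x b * x c \<le> 3 * p\<^sup>2" "x a * x b * x c \<le> p ^ 3"
    using esym3_le_mean[OF ab(1-3) p_def] by auto
  have pq: "0 \<le> p" "p \<le> q" using ab le by (auto simp: p_def q_def)
  have s: "x a + x b + x c = 3 * p" by (simp add: p_def)
  obtain \<alpha> \<delta> where nn: "0 \<le> \<alpha>" "0 \<le> \<delta>" and prod: "\<alpha> * \<delta> = p\<^sup>2" and sum: "3 * \<alpha> + \<delta> = 3 * p + q"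
    and e2: "p\<^sup>2 + p * q \<le> \<alpha>\<^sup>2 + \<alpha> * \<delta>"
    and e3: "p ^ 3 + 3 * p\<^sup>2 * q \<le> \<alpha> ^ 3 + 3 * \<alpha>\<^sup>2 * \<delta>" and e4: "p ^ 3 * q \<le> \<alpha> ^ 3 * \<delta>"
    using star_weights_exist[OF pq] by blast
  \<comment> \<open>The vertex \<open>a\<close> becomes the center of the star; the heaviest vertex
    \<open>d\<close> joins \<open>b\<close> and \<open>c\<close> as a leaf.\<close>
  define z where "z = x(a := \<delta>, b := \<alpha>, c := \<alpha>, d := \<alpha>)"
  have z: "z a = \<delta>" "z b = \<alpha>" "z c = \<alpha>" "z d = \<alpha>" using dist by (auto simp: z_def)
  have zW: "z i = x i" if "i \<in> W" for i using that disj by (auto simp: z_def)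
  have xW: "0 \<le> x i" if "i \<in> W" for i using that nonneg V by auto
  define E where "E j = esym_below r j W x" for j
  have E: "0 \<le> E j" for j unfolding E_def by (rule esym_below_nonneg) (use W xW in auto)
  have Ez: "esym_below r j W z = E j" for j
    unfolding E_def esym_below_def edge_poly_def using zW
    by (auto intro!: sum.cong prod.cong simp: nsets_def)
  define Q where "Q = (\<Prod>i\<in>T. x i)"
  have Qz: "(\<Prod>i\<in>T. z i) = Q" unfolding Q_def using T zW by (intro prod.cong) auto
  \<comment> \<open>\<open>Q\<close> is one of the nonnegative summands of
    \<open>E 2\<close>.\<close>
  have "T \<in> [W]\<^bsup>(r - 2)\<^esup>" using T W by (auto simp: nsets_def intro: finite_subset)
  then have QE: "Q \<le> E 2"
    using T W xW unfolding Q_def E_def esym_below_def edge_poly_def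
    by (auto intro!: member_le_sum prod_nonneg simp: finite_imp_finite_nsets nsets_def)
  have px: "edge_poly ([V]\<^bsup>r\<^esup>) x = E 0 + (3 * p + q) * E 1
     + (x a * x b + x a * x c + x b * x c + 3 * p * q) * E 2
     + (x a * x b * x c + (x a * x b + x a * x c + x b * x c) * q) * E 3
     + x a * x b * x c * q * E 4"
    using esym_below_insert4[OF W dist disj, of r x] s
    by (simp add: V[symmetric] esym_below_def[of r 0 V] E_def[symmetric] q_def[symmetric])
  have q_eq: "q = 3 * \<alpha> + \<delta> - 3 * p" using sum by simp
  have pz: "edge_poly ([V]\<^bsup>r\<^esup>) z = E 0 + (3 * p + q) * E 1 + (3 * (\<alpha>\<^sup>2 + \<alpha> * \<delta>)) * E 2
     + (\<alpha> ^ 3 + 3 * \<alpha>\<^sup>2 * \<delta>) * E 3 + \<alpha> ^ 3 * \<delta> * E 4"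
    using esym_below_insert4[OF W dist disj, of r z] q_eq
    by (simp add: V[symmetric] esym_below_def[of r 0 V] Ez z algebra_simps
        power2_eq_square power3_eq_cube)
  have "edge_poly ([V]\<^bsup>r\<^esup>) x - (x a * x b + x a * x c + x b * x c) * Q
     = E 0 + (3 * p + q) * E 1
     + (x a * x b + x a * x c + x b * x c) * (E 2 - Q) + 3 * p * q * E 2
     + (x a * x b * x c + (x a * x b + x a * x c + x b * x c) * q) * E 3
     + x a * x b * x c * q * E 4"
    unfolding px by (simp add: algebra_simps)
  \<comment> \<open>This is the averaging: the symmetric sums of the weights of \<open>a\<close>,
    \<open>b\<close>, \<open>c\<close> are bounded by their values at three equal weights
    \<open>p\<close>.\<close>
  also have "\<dots> \<le> E 0 + (3 * p + q) * E 1 + 3 * p\<^sup>2 * (E 2 - Q) + 3 * p * q * E 2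
     + (p ^ 3 + 3 * p\<^sup>2 * q) * E 3 + p ^ 3 * q * E 4"
    using mean E QE pq by (intro add_mono mult_right_mono order_refl) auto
  also have "\<dots> = E 0 + (3 * p + q) * E 1 + (3 * (p\<^sup>2 + p * q)) * E 2
     + (p ^ 3 + 3 * p\<^sup>2 * q) * E 3 + p ^ 3 * q * E 4 - 3 * p\<^sup>2 * Q"
    by (simp add: algebra_simps)
  also have "\<dots> \<le> edge_poly ([V]\<^bsup>r\<^esup>) z - 3 * p\<^sup>2 * Q"
  proof -
    have "3 * (p\<^sup>2 + p * q) * E 2 \<le> 3 * (\<alpha>\<^sup>2 + \<alpha> * \<delta>) * E 2"
      using e2 E by (intro mult_right_mono mult_left_mono) auto
    moreover have "(p ^ 3 + 3 * p\<^sup>2 * q) * E 3 \<le> (\<alpha> ^ 3 + 3 * \<alpha>\<^sup>2 * \<delta>) * E 3"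
      using e3 E by (rule mult_right_mono)
    moreover have "p ^ 3 * q * E 4 \<le> \<alpha> ^ 3 * \<delta> * E 4" using e4 E by (rule mult_right_mono)
    ultimately show ?thesis unfolding pz by linarith
  qed
  also have "3 * p\<^sup>2 * Q = z a * (z b + z c + z d) * (\<Prod>i\<in>T. z i)"
    by (simp add: z Qz prod[symmetric])
  finally have main: "edge_poly ([V]\<^bsup>r\<^esup>) x - (x a * x b + x a * x c + x b * x c) * (\<Prod>i\<in>T. x i)
      \<le> edge_poly ([V]\<^bsup>r\<^esup>) z - z a * (z b + z c + z d) * (\<Prod>i\<in>T. z i)"
    by (simp add: Q_def)
  show ?thesis
  proof (rule that[OF _ _ main])
    show "0 \<le> z i" if "i \<in> V" for i using that nonneg nn by (auto simp: z_def)
    have "sum z W = sum x W" using zW by (intro sum.cong) auto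
    then show "sum z V = sum x V"
      unfolding V using W dist disj z sum s by (simp add: q_def)
  qed
qed

section \<open>The three lightest sets under decreasing weights\<close>

lemma nsets_Suc_minE:
  fixes A :: "nat set"
  assumes "A \<in> [{1..t}]\<^bsup>Suc k\<^esup>"
  obtains i A' where "A = insert i A'" "i \<notin> A'" "A' \<in> [{1..t}]\<^bsup>k\<^esup>" "A' \<subseteq> {i<..t}" "1 \<le> i" "i + k \<le> t"
proof -
  have A: "A \<subseteq> {1..t}" "finite A" "card A = Suc k" using assms by (auto simp: nsets_def)
  then have ne: "A \<noteq> {}" by auto
  define i A' where "i = Min A" and "A' = A - {i}"
  have i: "i \<in> A" using A ne by (simp add: i_def)
  have A': "A' \<subseteq> {i<..t}"
  proof
    fix j assume "j \<in> A'"
    then have "j \<in> A" "j \<noteq> i" "i \<le> j" using A by (auto simp: A'_def i_def)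
    then show "j \<in> {i<..t}" using A by auto
  qed
  have cA': "card A' = k" using A i by (simp add: A'_def)
  have "card A' \<le> t - i" using card_mono[OF _ A'] by simp
  moreover have "1 \<le> i" "i \<le> t" using i A by auto
  moreover have "A = insert i A'" using i by (auto simp: A'_def)
  moreover have "A' \<in> [{1..t}]\<^bsup>k\<^esup>" using A cA' by (auto simp: A'_def nsets_def)
  moreover have "i \<notin> A'" by (simp add: A'_def)
  ultimately show ?thesis
    using that[of i A'] A' \<open>card A' \<le> t - i\<close> cA' by simp
qed

context
  fixes y :: "nat \<Rightarrow> real" and t :: nat
  assumes antimono: "antimono_on {1..t} y" and nonneg: "\<And>i. i \<in> {1..t} \<Longrightarrow> 0 \<le> y i"
begin

lemma weight_le: "1 \<le> i \<Longrightarrow> i \<le> j \<Longrightarrow> j \<le> t \<Longrightarrow> y j \<le> y i"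
  using antimono by (auto simp: monotone_on_def)

lemma prod_insert_le:
  assumes "1 \<le> i" "i \<le> j" "j \<le> t" "i \<notin> A" "j \<notin> B" "finite A" "finite B" "B \<subseteq> {1..t}"
    "prod y B \<le> prod y A"
  shows "prod y (insert j B) \<le> prod y (insert i A)"
proof -
  have "y j * prod y B \<le> y i * prod y A"
    using assms nonneg weight_le by (intro mult_mono prod_nonneg) auto
  then show ?thesis using assms by simp
qed

text \<open>Induction on the size: the minimum of a set of \<open>Suc k\<close> vertices is at most
  \<open>t - k\<close>, so it weighs at least as much as the vertex \<open>t - k\<close>, and the
  induction hypothesis handles the rest.\<close>

lemma prod_top_le:
  "A \<in> [{1..t}]\<^bsup>k\<^esup> \<Longrightarrow> prod y {t - k<..t} \<le> prod y A"
proof (induction k arbitrary: A)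
  case 0
  then show ?case by (auto simp: nsets_def)
next
  case (Suc k)
  obtain i A' where A: "A = insert i A'" "i \<notin> A'" "A' \<in> [{1..t}]\<^bsup>k\<^esup>" "1 \<le> i" "i + k \<le> t"
    using nsets_Suc_minE[OF Suc.prems] by metis
  have "{t - Suc k<..t} = insert (t - k) {t - k<..t}" using A by auto
  then show ?case
    unfolding A(1) using A Suc.IH[OF A(3)]
    by (simp only:) (intro prod_insert_le, auto simp: nsets_def)
qed

text \<open>With minimum \<open>t - k\<close> the other \<open>k\<close> elements would have to fill
  \<open>{t - k<..t}\<close>. Hence the minimum is at most \<open>t - k - 1\<close>, and the product
  over the other elements is at least that over the top \<open>k\<close> vertices.\<close>

lemma prod_second_top_le:
  assumes "A \<in> [{1..t}]\<^bsup>Suc k\<^esup>" "A \<noteq> insert (t - k) {t - k<..t}"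
  shows "prod y (insert (t - k - 1) {t - k<..t}) \<le> prod y A"
proof -
  obtain i A' where A: "A = insert i A'" "i \<notin> A'" "A' \<in> [{1..t}]\<^bsup>k\<^esup>" "A' \<subseteq> {i<..t}" "1 \<le> i" "i + k \<le> t"
    using nsets_Suc_minE[OF assms(1)] by metis
  have "i \<noteq> t - k"
  proof
    assume i: "i = t - k"
    have "A' = {t - k<..t}" using A i by (intro card_subset_eq) (auto simp: nsets_def)
    then show False using A i assms by auto
  qed
  then show ?thesis
    unfolding A(1) using A prod_top_le[OF A(3)]
    by (intro prod_insert_le) (auto simp: nsets_def)
qed

text \<open>The minimum is at most \<open>t - k - 1\<close>. If it is smaller, the last set of the
  star is a lower bound. If it is equal, the remaining \<open>k\<close> elements are not the top
  \<open>k\<close>, and the second lightest \<open>k\<close>-set yields the last set of the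
  triangle. Neither candidate is always the lighter one, hence the disjunction.\<close>

lemma prod_third_top_le:
  assumes "A \<in> [{1..t}]\<^bsup>Suc k\<^esup>"
    "A \<noteq> insert (t - k) {t - k<..t}" "A \<noteq> insert (t - k - 1) {t - k<..t}"
  shows "k + 2 < t \<and> prod y (insert (t - k - 2) {t - k<..t}) \<le> prod y A \<or>
    1 \<le> k \<and> prod y (insert (t - k - 1) (insert (t - k) {t - k + 1<..t})) \<le> prod y A"
proof -
  obtain i A' where A: "A = insert i A'" "i \<notin> A'" "A' \<in> [{1..t}]\<^bsup>k\<^esup>" "A' \<subseteq> {i<..t}" "1 \<le> i" "i + k \<le> t"
    using nsets_Suc_minE[OF assms(1)] by metis
  have A': "finite A'" "card A' = k" using A by (auto simp: nsets_def)
  have i: "i \<noteq> t - k"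
  proof
    assume i: "i = t - k"
    have "A' = {t - k<..t}" using A i by (intro card_subset_eq) (auto simp: nsets_def)
    then show False using A i assms by auto
  qed
  show ?thesis
  proof (cases "i = t - k - 1")
    case False
    then have "prod y (insert (t - k - 2) {t - k<..t}) \<le> prod y A"
      unfolding A(1) using A i prod_top_le[OF A(3)]
      by (intro prod_insert_le) (auto simp: nsets_def)
    then show ?thesis using False A i by linarith
  next
    case True
    have ne: "A' \<noteq> {t - k<..t}" using True A assms by auto
    then have "k \<noteq> 0" using A' by auto
    then obtain l where l: "k = Suc l" using not0_implies_Suc by blast
    \<comment> \<open>\<open>prod_second_top_le\<close> is applied one size down, with
      \<open>l = k - 1\<close>; these equations rewrite its sets in terms of
      \<open>k\<close>.\<close>
    have eq: "t - l - 1 = t - k" "t - l = t - k + 1" "insert (t - l) {t - l<..t} = {t - k<..t}"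
      using l A i by auto
    have "prod y (insert (t - k) {t - k + 1<..t}) \<le> prod y A'"
      using prod_second_top_le[of A' l] A(3) ne unfolding l[symmetric] eq(1,3) unfolding eq(2) by simp
    then have "prod y (insert (t - k - 1) (insert (t - k) {t - k + 1<..t})) \<le> prod y A"
      unfolding A(1) using A i True
      by (intro prod_insert_le) (auto simp: nsets_def)
    then show ?thesis using l by simp
  qed
qed

text \<open>One of the three sets, \<open>C\<close>, avoids the two lightest; of the other two, one,
  \<open>B\<close>, is not the lightest. The bounds for the first, second and third place then apply
  to \<open>A\<close>, \<open>B\<close> and \<open>C\<close> and add up.\<close>

lemma sum_prod_three_ge:
  assumes "M \<subseteq> [{1..t}]\<^bsup>Suc k\<^esup>" "card M = 3"
  obtains "k + 2 < t" "prod y (insert (t - k) {t - k<..t}) + prod y (insert (t - k - 1) {t - k<..t})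
      + prod y (insert (t - k - 2) {t - k<..t}) \<le> (\<Sum>A\<in>M. prod y A)"
  | "1 \<le> k" "prod y (insert (t - k) {t - k<..t}) + prod y (insert (t - k - 1) {t - k<..t})
      + prod y (insert (t - k - 1) (insert (t - k) {t - k + 1<..t})) \<le> (\<Sum>A\<in>M. prod y A)"
proof -
  have escape: "\<exists>A\<in>M. A \<noteq> B \<and> A \<noteq> C" for B C
  proof (rule ccontr)
    assume "\<not> ?thesis"
    then have "M \<subseteq> {B, C}" by auto
    from card_mono[OF _ this] show False using assms card_2_iff card_insert_le_m1[of 2 "{C}" B] by auto
  qed
  obtain C where C: "C \<in> M" "C \<noteq> insert (t - k) {t - k<..t}" "C \<noteq> insert (t - k - 1) {t - k<..t}"
    using escape by metis
  obtain B where B: "B \<in> M" "B \<noteq> insert (t - k) {t - k<..t}" "B \<noteq> C" using escape by metis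
  obtain A where A: "A \<in> M" "A \<noteq> B" "A \<noteq> C" using escape by metis
  have "finite M" using assms(2) by (metis card.infinite zero_neq_numeral)
  moreover have "{A, B, C} \<subseteq> M" using A B C by simp
  moreover have "card {A, B, C} = card M" using assms(2) A B by simp
  ultimately have "M = {A, B, C}" using card_subset_eq by metis
  then have sum: "(\<Sum>A\<in>M. prod y A) = prod y A + prod y B + prod y C" using A B by simp
  have "A \<in> [{1..t}]\<^bsup>Suc k\<^esup>" using A assms by auto
  then obtain i where "1 \<le> i" "i + k \<le> t" by (metis nsets_Suc_minE)
  then have "1 \<le> t - k" by simp
  then have "insert (t - k) {t - k<..t} = {t - Suc k<..t}" by auto
  then have "prod y (insert (t - k) {t - k<..t}) \<le> prod y A"
    using prod_top_le[of A "Suc k"] A assms by auto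
  moreover have "prod y (insert (t - k - 1) {t - k<..t}) \<le> prod y B"
    using prod_second_top_le[of B k] B assms by auto
  ultimately show ?thesis
    using prod_third_top_le[of C k] C assms sum that by (smt (verit) subsetD)
qed

end

section \<open>The sets omitted by colex\<close>

lemma colex_edges_eq_Diff:
  assumes "N \<subseteq> [{1..t}]\<^bsup>r\<^esup>" "m + card N = t choose r"
    and less: "\<And>A B. A \<in> [{1..t}]\<^bsup>r\<^esup> \<Longrightarrow> A \<notin> N \<Longrightarrow> B \<in> N \<Longrightarrow> colex_less A B"
  shows "colex_edges r m = [{1..t}]\<^bsup>r\<^esup> - N"
proof (rule card_subset_eq)
  have m: "m \<le> t choose r" using assms by simp
  have fin: "finite ([{1..t}]\<^bsup>r\<^esup>)" by (simp add: finite_imp_finite_nsets)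
  then show "finite ([{1..t}]\<^bsup>r\<^esup> - N)" by simp
  have card: "card ([{1..t}]\<^bsup>r\<^esup> - N) = m"
    using assms fin by (simp add: card_Diff_subset finite_subset)
  then show "card (colex_edges r m) = card ([{1..t}]\<^bsup>r\<^esup> - N)"
    using colex_edges_r_graph(2)[OF m] by simp
  have "B \<notin> colex_edges r m" if "B \<in> N" for B
  proof
    assume B: "B \<in> colex_edges r m"
    \<comment> \<open>All \<open>m\<close> sets outside \<open>N\<close> precede \<open>B\<close>,
      so \<open>B\<close> has too many predecessors to be among the first \<open>m\<close>.\<close>
    have "[{1..t}]\<^bsup>r\<^esup> - N \<subseteq> {A \<in> [{1..}]\<^bsup>r\<^esup>. colex_less A B}"
      using less that by (auto simp: nsets_def)
    moreover have "finite {A \<in> [{1..}]\<^bsup>r\<^esup>. colex_less A B}"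
      using B by (intro colex_predecessors_finite) (simp add: colex_edges_def)
    ultimately have "m \<le> card {A \<in> [{1..}]\<^bsup>r\<^esup>. colex_less A B}"
      using card card_mono by metis
    then show False using B by (simp add: colex_edges_def)
  qed
  then show "colex_edges r m \<subseteq> [{1..t}]\<^bsup>r\<^esup> - N"
    using colex_edges_r_graph(1)[OF m] by (auto simp: r_graph_def)
qed

text \<open>If \<open>A\<close> misses some of the top \<open>k\<close> vertices, the greatest one
  missing is its greatest difference from \<open>B\<close>. If \<open>A\<close> contains them all,
  its one other vertex lies below \<open>t - k - 2\<close>, and the extra vertex \<open>i\<close> of
  \<open>B\<close> decides.\<close>

lemma colex_edges_eq_star:
  assumes "k + 2 < t" "m + 3 = t choose Suc k"
  shows "colex_edges (Suc k) m = [{1..t}]\<^bsup>Suc k\<^esup>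
    - {insert (t - k) {t - k<..t}, insert (t - k - 1) {t - k<..t}, insert (t - k - 2) {t - k<..t}}"
    (is "_ = _ - ?N")
proof (rule colex_edges_eq_Diff)
  have N: "?N = (\<lambda>i. insert i {t - k<..t}) ` {t - k, t - k - 1, t - k - 2}" by simp
  have "inj_on (\<lambda>i. insert i {t - k<..t}) {t - k, t - k - 1, t - k - 2}"
    by (auto simp: inj_on_def insert_eq_iff)
  then have "card ?N = card {t - k, t - k - 1, t - k - 2}" unfolding N by (rule card_image)
  moreover have "t - k \<noteq> t - k - 1" "t - k \<noteq> t - k - 2" "t - k - 1 \<noteq> t - k - 2" using assms by auto
  then have "card {t - k, t - k - 1, t - k - 2} = 3" by (simp add: card_insert_if)
  ultimately show "m + card ?N = t choose Suc k" using assms by simp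
  show "?N \<subseteq> [{1..t}]\<^bsup>Suc k\<^esup>"
    using assms by (auto simp: nsets_def card_insert_if)
  fix A B assume A: "A \<in> [{1..t}]\<^bsup>Suc k\<^esup>" "A \<notin> ?N" and B: "B \<in> ?N"
  have fin: "finite A" "A \<subseteq> {1..t}" "card A = Suc k" using A by (auto simp: nsets_def)
  obtain i where i: "B = insert i {t - k<..t}" "i \<in> {t - k, t - k - 1, t - k - 2}" using B by auto
  have "\<exists>l. l \<in> B \<and> l \<notin> A \<and> (\<forall>j>l. j \<in> A \<longleftrightarrow> j \<in> B)"
  proof (cases "{t - k<..t} \<subseteq> A")
    case True
    have "card (A - {t - k<..t}) = 1" using True fin assms by (simp add: card_Diff_subset)
    then obtain j where "A - {t - k<..t} = {j}" by (rule card_1_singletonE)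
    then have Aj: "A = insert j {t - k<..t}" "j \<notin> {t - k<..t}" using True by auto
    then have "j \<le> t" "j \<noteq> t - k" "j \<noteq> t - k - 1" "j \<noteq> t - k - 2" using A fin by auto
    then have "j < i" using Aj(2) i by auto
    then show ?thesis using Aj i by (intro exI[of _ i]) auto
  next
    case False
    define l where "l = Max ({t - k<..t} - A)"
    have "l \<in> {t - k<..t} - A" unfolding l_def using False by (intro Max_in) auto
    moreover have "j \<in> A \<longleftrightarrow> j \<in> B" if "j > l" for j
    proof -
      have "j \<notin> {t - k<..t} - A"
      proof
        assume "j \<in> {t - k<..t} - A"
        then have "j \<le> l" unfolding l_def by (intro Max_ge) auto
        then show False using that by simp
      qed
      then show ?thesis using that calculation i fin by auto
    qed
    ultimately show ?thesis using i by (intro exI[of _ l]) auto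
  qed
  then show "colex_less A B" using colex_less_iff[of A B] fin i by simp
qed

text \<open>Sets of size \<open>t - 1\<close> are complements of single vertices, and colex lists
  them by decreasing omitted vertex. The last three omit 3, 2 and 1; vertex 3 exists since
  \<open>1 \<le> k\<close>.\<close>

lemma colex_edges_eq_triangle:
  assumes "1 \<le> k" "t = k + 2" "m + 3 = t choose Suc k"
  shows "colex_edges (Suc k) m = [{1..t}]\<^bsup>Suc k\<^esup>
    - {insert (t - k) {t - k<..t}, insert (t - k - 1) {t - k<..t},
       insert (t - k - 1) (insert (t - k) {t - k + 1<..t})}"
    (is "_ = _ - ?N")
proof (rule colex_edges_eq_Diff)
  have N: "?N = (\<lambda>i. {1..t} - {i}) ` {1, 2, 3}"
  proof -
    have tk: "t - k = 2" using assms by simp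
    have "insert 2 {2<..t} = {1..t} - {1}" "insert (2 - 1) {2<..t} = {1..t} - {2}"
      "insert (2 - 1) (insert 2 {2 + 1<..t}) = {1..t} - {3}"
      using assms by auto
    then show ?thesis unfolding tk by simp
  qed
  have "inj_on (\<lambda>i. {1..t} - {i}) {1, 2, 3}"
  proof (rule inj_onI)
    fix i j assume ij: "i \<in> {1, 2, 3}" "{1..t} - {i} = {1..t} - {j}"
    have "i \<in> {1..t}" using ij(1) assms(1,2) by auto
    then show "i = j" using ij(2) by blast
  qed
  then have "card ?N = card {1, 2, 3 :: nat}" unfolding N by (rule card_image)
  then show "m + card ?N = t choose Suc k" using assms by simp
  show "?N \<subseteq> [{1..t}]\<^bsup>Suc k\<^esup>"
    unfolding N using assms by (auto simp: nsets_def)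
  fix A B assume A: "A \<in> [{1..t}]\<^bsup>Suc k\<^esup>" "A \<notin> ?N" and B: "B \<in> ?N"
  have fin: "finite A" "A \<subseteq> {1..t}" "card A = Suc k" using A by (auto simp: nsets_def)
  obtain i where i: "B = {1..t} - {i}" "i \<in> {1, 2, 3}" using B unfolding N by auto
  have "card ({1..t} - A) = 1" using fin assms by (simp add: card_Diff_subset)
  then obtain j where "{1..t} - A = {j}" by (rule card_1_singletonE)
  then have j: "A = {1..t} - {j}" "j \<in> {1..t}" using fin by auto
  then have "j \<notin> {1, 2, 3}" using A unfolding N by blast
  then have "i < j" using i j by auto
  then have "\<exists>l. l \<in> B \<and> l \<notin> A \<and> (\<forall>n>l. n \<in> A \<longleftrightarrow> n \<in> B)"
    using i j by (intro exI[of _ j]) auto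
  then show "colex_less A B" using colex_less_iff[of A B] fin i by simp
qed

section \<open>Relabelling and comparison of the missing sets\<close>

lemma edge_poly_Diff:
  assumes "finite E" "N \<subseteq> E"
  shows "edge_poly (E - N) x = edge_poly E x - (\<Sum>e\<in>N. prod x e)"
  using assms by (simp add: edge_poly_def sum_diff)

lemma sorted_relabelling:
  fixes V :: "'a set" and x :: "'a \<Rightarrow> real"
  assumes "r_graph r V E" "card V = t" "x \<in> weightings V"
  obtains F y where "F \<subseteq> [{1..t}]\<^bsup>r\<^esup>" "card F = card E" "y \<in> weightings {1..t}"
    "antimono_on {1..t} y" "edge_poly F y = edge_poly E x"
proof -
  have V: "finite V" and E: "E \<subseteq> [V]\<^bsup>r\<^esup>" using assms by (auto simp: r_graph_def)
  obtain vs where vs: "set vs = V" "distinct vs" using finite_distinct_list[OF V] by auto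
  \<comment> \<open>\<open>sort_key\<close> sorts upwards, so the negated weights put the heaviest
    vertex first.\<close>
  define xs where "xs = sort_key (\<lambda>v. - x v) vs"
  have xs: "set xs = V" "distinct xs" "length xs = t"
    using vs assms distinct_card[of vs] by (auto simp: xs_def)
  have srt: "sorted (map (\<lambda>v. - x v) xs)" by (simp add: xs_def)
  \<comment> \<open>List positions start at 0, the new vertices at 1.\<close>
  define f where "f i = xs ! (i - 1)" for i
  have bij: "bij_betw f {1..t} V"
  proof (rule bij_betw_byWitness[where f' = "\<lambda>v. Suc (THE i. i < t \<and> xs ! i = v)"])
    show "\<forall>i\<in>{1..t}. Suc (THE j. j < t \<and> xs ! j = f i) = i"
    proof
      fix i assume "i \<in> {1..t}"
      then have "(THE j. j < t \<and> xs ! j = f i) = i - 1"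
        using xs by (intro the_equality) (auto simp: f_def nth_eq_iff_index_eq)
      then show "Suc (THE j. j < t \<and> xs ! j = f i) = i" using \<open>i \<in> {1..t}\<close> by simp
    qed
    have the: "(THE i. i < t \<and> xs ! i = v) < t \<and> xs ! (THE i. i < t \<and> xs ! i = v) = v" if "v \<in> V" for v
      using theI'[OF distinct_Ex1[OF xs(2)]] that xs by simp
    show "\<forall>v\<in>V. f (Suc (THE i. i < t \<and> xs ! i = v)) = v" using the by (simp add: f_def)
    show "f ` {1..t} \<subseteq> V" using xs by (auto simp: f_def)
    show "(\<lambda>v. Suc (THE i. i < t \<and> xs ! i = v)) ` V \<subseteq> {1..t}" using the by (auto simp: Suc_le_eq)
  qed
  \<comment> \<open>Weights are pulled back along \<open>f\<close>, whereas edges are pushed forward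
    along its inverse \<open>g\<close>.\<close>
  define g where "g = inv_into {1..t} f"
  have g: "bij_betw g V {1..t}" unfolding g_def by (rule bij_betw_inv_into[OF bij])
  have fg: "f (g v) = v" if "v \<in> V" for v
    using that bij by (simp add: g_def bij_betw_inv_into_right)
  define y where "y = x \<circ> f"
  have inj: "inj_on g e" if "e \<in> E" for e
    using that E g by (auto simp: nsets_def bij_betw_def intro: inj_on_subset)
  have injE: "inj_on (image g) E"
    using E g by (intro inj_on_subset[OF inj_on_image_Pow[of g V]]) (auto simp: nsets_def bij_betw_def)
  show ?thesis
  proof
    show "image g ` E \<subseteq> [{1..t}]\<^bsup>r\<^esup>"
    proof clarify
      fix e assume e: "e \<in> E"
      then have eV: "e \<subseteq> V" "finite e" "card e = r" using E by (auto simp: nsets_def)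
      have "g ` e \<subseteq> {1..t}" using image_mono[OF eV(1), of g] g by (simp add: bij_betw_def)
      then show "g ` e \<in> [{1..t}]\<^bsup>r\<^esup>" using eV card_image[OF inj[OF e]] by (simp add: nsets_def)
    qed
    show "card (image g ` E) = card E" using injE by (rule card_image)
    have "(\<Sum>i\<in>{1..t}. y i) = (\<Sum>v\<in>V. x v)"
      unfolding y_def comp_def by (rule sum.reindex_bij_betw[OF bij])
    moreover have "0 \<le> y i" if "i \<in> {1..t}" for i
      using that assms bij_betwE[OF bij] by (auto simp: weightings_def y_def)
    ultimately show "y \<in> weightings {1..t}" using assms by (simp add: weightings_def)
    show "antimono_on {1..t} y"
    proof (rule monotone_onI)
      fix i j assume "i \<in> {1..t}" "j \<in> {1..t}" "i \<le> j"
      then show "y j \<le> y i"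
        using sorted_nth_mono[OF srt, of "i - 1" "j - 1"] xs by (simp add: y_def f_def)
    qed
    have "prod y (g ` e) = prod x e" if "e \<in> E" for e
    proof -
      have "prod y (g ` e) = (\<Prod>v\<in>e. y (g v))" using inj[OF that] by (rule prod.reindex_cong) auto
      also have "\<dots> = prod x e"
      proof (rule prod.cong)
        fix v assume "v \<in> e"
        then have "v \<in> V" using that E by (auto simp: nsets_def)
        then show "y (g v) = x v" using fg by (simp add: y_def)
      qed simp
      finally show ?thesis .
    qed
    then show "edge_poly (image g ` E) y = edge_poly E x"
      unfolding edge_poly_def sum.reindex[OF injE] by simp
  qed
qed

theorem theorem1p7:
  fixes r m t :: nat and V :: "'a set" and E :: "'a set set"
  assumes "r > 0" and "m > 0" and "t > 0"
    and "int m = int (t choose r) - 3"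
    and "r_graph r V E" and "card V = t" and "card E = m"
  shows "lagrangian {1..t} (colex_edges r m) \<ge> lagrangian V E"
proof -
  obtain k where k: "r = Suc k" using assms(1) gr0_implies_Suc by blast
  have "int (m + 3) = int (t choose Suc k)" using assms(4) k by simp
  then have m: "m + 3 = t choose Suc k" by (simp only: of_nat_eq_iff)
  have "Suc k < t"
  proof (rule ccontr)
    assume "\<not> Suc k < t"
    then have "t choose Suc k \<le> 1" by (cases "t = Suc k") (auto simp: binomial_eq_0)
    then show False using m assms by simp
  qed
  then have kt: "k + 2 \<le> t" by simp
  have "V \<noteq> {}" using assms by auto
  then obtain x where x: "x \<in> weightings V" "edge_poly E x = lagrangian V E"
    using lagrangian_attained[OF assms(5)] by blast
  obtain F y where F: "F \<subseteq> [{1..t}]\<^bsup>r\<^esup>" "card F = m" and y: "y \<in> weightings {1..t}"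
    "antimono_on {1..t} y" "edge_poly F y = lagrangian V E"
    using sorted_relabelling[OF assms(5,6) x(1)] assms(7) x(2) by metis
  have y0: "0 \<le> y i" if "i \<in> {1..t}" for i using y that by (auto simp: weightings_def)
  let ?K = "[{1..t}]\<^bsup>Suc k\<^esup>"
  have fK: "finite ?K" by (simp add: finite_imp_finite_nsets)
  define M where "M = ?K - F"
  have M: "M \<subseteq> ?K" "card M = 3"
    using F k m fK by (auto simp: M_def card_Diff_subset finite_subset)
  have F_eq: "F = ?K - M" using F k by (auto simp: M_def)
  have yF: "lagrangian V E = edge_poly ?K y - (\<Sum>e\<in>M. prod y e)"
    using edge_poly_Diff[OF fK M(1), of y] y(3) F_eq by simp
  have "r_graph r {1..t} (colex_edges r m)"
    using colex_edges_r_graph(1) m k by (metis le_add1)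
  then have bound: "edge_poly (colex_edges r m) z \<le> lagrangian {1..t} (colex_edges r m)"
    if "z \<in> weightings {1..t}" for z
    using lagrangian_attained[of r "{1..t}"] that assms(3) by fastforce
  let ?L1 = "insert (t - k) {t - k<..t}"
  let ?L2 = "insert (t - k - 1) {t - k<..t}"
  \<comment> \<open>For \<open>k + 2 = t\<close> this is not an \<open>r\<close>-set of vertices,
    since \<open>t - k - 2\<close> is then 0; it is used only for \<open>k + 2 < t\<close>.\<close>
  let ?S = "insert (t - k - 2) {t - k<..t}"
  let ?T = "insert (t - k - 1) (insert (t - k) {t - k + 1<..t})"
  have star: "edge_poly (colex_edges r m) z = edge_poly ?K z - (prod z ?L1 + prod z ?L2 + prod z ?S)"
    if "k + 2 < t" for z
  proof -
    have "?L1 \<noteq> ?L2" "?L1 \<noteq> ?S" "?L2 \<noteq> ?S" using that by (auto simp: insert_eq_iff)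
    moreover have "{?L1, ?L2, ?S} \<subseteq> ?K" using that by (auto simp: nsets_def card_insert_if)
    ultimately show ?thesis
      unfolding k colex_edges_eq_star[OF that m] by (subst edge_poly_Diff[OF fK]) auto
  qed
  show ?thesis
  proof (rule sum_prod_three_ge[OF y(2) y0 M])
    \<comment> \<open>Here the star weighs no more than the sets missing from \<open>F\<close>, so
      \<open>y\<close> itself serves as a weighting for colex.\<close>
    assume "k + 2 < t" and "prod y ?L1 + prod y ?L2 + prod y ?S \<le> (\<Sum>A\<in>M. prod y A)"
    then show ?thesis using star[of y] bound[OF y(1)] yF by linarith
  next
    assume k1: "1 \<le> k" and le: "prod y ?L1 + prod y ?L2 + prod y ?T \<le> (\<Sum>A\<in>M. prod y A)"
    show ?thesis
    proof (cases "k + 2 = t")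
      case True
      \<comment> \<open>The three sets omit 1, 2 and 3 respectively; membership of 1 and of
        \<open>t - k + 1 = 3\<close> tells them apart.\<close>
      have "1 \<in> ?L2" "1 \<notin> ?L1" "1 \<in> ?T" "t - k + 1 \<in> ?L1" "t - k + 1 \<in> ?L2" "t - k + 1 \<notin> ?T"
        using True k1 by auto
      then have "?L1 \<noteq> ?L2" "?L1 \<noteq> ?T" "?L2 \<noteq> ?T" by metis+
      moreover have "{?L1, ?L2, ?T} \<subseteq> ?K" using True k1 by (auto simp: nsets_def card_insert_if)
      ultimately have "edge_poly (colex_edges r m) y
          = edge_poly ?K y - (prod y ?L1 + prod y ?L2 + prod y ?T)"
        unfolding k colex_edges_eq_triangle[OF k1 True[symmetric] m]
        by (subst edge_poly_Diff[OF fK]) auto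
      then show ?thesis using bound[OF y(1)] yF le by linarith
    next
      case False
      define a b c d where "a = t - k + 1" and "b = t - k" and "c = t - k - 1" and "d = t - k - 2"
      define T where "T = {a<..t}"
      define W where "W = {1..<d} \<union> T"
      note abcd = a_def b_def c_def d_def
      have kt': "k + 2 < t" using False kt by simp
      have B: "{t - k<..t} = insert a T" "{t - k + 1<..t} = T" "a \<notin> T"
        using k1 kt' by (auto simp: abcd T_def)
      have notT: "b \<notin> T" "c \<notin> T" "d \<notin> T" "finite T" by (auto simp: abcd T_def)
      have neq: "a \<noteq> b" "a \<noteq> c" "a \<noteq> d" "b \<noteq> c" "b \<noteq> d" "c \<noteq> d" using kt' by (auto simp: abcd)
      have sets: "?L1 = insert b (insert a T)" "?L2 = insert c (insert a T)"
        "?S = insert d (insert a T)" "?T = insert c (insert b T)"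
        by (simp_all only: B abcd)
      have prods: "prod z ?L1 = z b * (z a * prod z T)" "prod z ?L2 = z c * (z a * prod z T)"
        "prod z ?S = z d * (z a * prod z T)" "prod z ?T = z c * (z b * prod z T)" for z :: "nat \<Rightarrow> real"
        unfolding sets using notT B neq by simp_all
      have V: "{1..t} = insert a (insert b (insert c (insert d W)))"
        using kt' k1 by (auto simp: abcd W_def T_def)
      \<comment> \<open>\<open>d\<close> has the smallest label of the four and so the largest
        weight, as the passage to star weights demands.\<close>
      have ord: "y a \<le> y d" "y b \<le> y d" "y c \<le> y d"
        using y(2) kt' k1 by (auto simp: monotone_on_def abcd)
      \<comment> \<open>Under \<open>y\<close> the star may weigh more than the sets missing from
        \<open>F\<close>, so colex needs another weighting.\<close>
      obtain z where z: "\<And>i. i \<in> {1..t} \<Longrightarrow> 0 \<le> z i" "sum z {1..t} = sum y {1..t}"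
        "edge_poly ([{1..t}]\<^bsup>r\<^esup>) y - (y a * y b + y a * y c + y b * y c) * prod y T
          \<le> edge_poly ([{1..t}]\<^bsup>r\<^esup>) z - z a * (z b + z c + z d) * prod z T"
      proof (rule triangle_le_star[OF _ _ _ V _ _ _ y0 ord])
        show "finite W" by (simp add: W_def T_def)
        show "distinct [a, b, c, d]" using neq by simp
        show "set [a, b, c, d] \<inter> W = {}" using kt' by (auto simp: W_def T_def abcd)
        show "T \<subseteq> W" by (simp add: W_def)
        show "card T = r - 2" using kt' k1 k by (simp add: T_def abcd)
        show "2 \<le> r" using k k1 by simp
      qed auto
      have zW: "z \<in> weightings {1..t}" using z y(1) by (simp add: weightings_def)
      have "lagrangian V E \<le> edge_poly ?K y - (y a * y b + y a * y c + y b * y c) * prod y T"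
        using yF le unfolding prods by (simp add: algebra_simps)
      also have "\<dots> \<le> edge_poly ?K z - z a * (z b + z c + z d) * prod z T"
        using z(3) k by simp
      also have "\<dots> = edge_poly (colex_edges r m) z"
        unfolding star[OF kt'] prods by (simp add: algebra_simps)
      finally show ?thesis using bound[OF zW] by linarith
    qed
  qed
qed

end
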